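(* Let $$P(T)=T^d+a_{d-1}T^{d-1}+\cdots+a_1T\in\mathbb Z[T],$$ with $a_i\ge0$ for $i=1,\dots,d-1$. Consider the family $\mathscr Y_P$ of branches $$\phi_q(t)=(t,qP(t)),\qquad q\in\mathbb Q_{>0}.$$ Then visibility is locally detectable for this family, i.e. $$\mathcal B^{\mathrm{vis}}(\mathscr Y_P)=\bigcap_{p\text{ prime}}\mathcal B_p^{\mathrm{vis}}(\mathscr Y_P),$$ if and only if $P(T)=T^d$.
   Context: The branch locus is $\mathcal B(\mathscr Y_P)=\{\phi_q(t)\in\mathbb Z^2:q\in\mathbb Q_{>0},\ t\in\mathbb R_{>0}\}$; each of its points equals $\phi_q(t)$ for a unique pair $(q,t)$. For $Q=(Q_1,Q_2)\in\mathbb Z^2$ and a prime $p$, put $v_p(Q)=\min(v_p(Q_1),v_p(Q_2))$, with $v_p$ the $p$-adic valuation and $v_p(0)=+\infty$. A point $\phi_q(t)\in\mathcal B(\mathscr Y_P)$ is globally visible if there is no $s$ with $0<s<t$ and $\phi_q(s)\in\mathbb Z^2$; it is $p$-adically visible if $v_p(\phi_q(t))\le v_p(\phi_q(s))$ for every $s$ with $0<s<t$ and $\phi_q(s)\in\mathbb Z^2$. $\mathcal B^{\mathrm{vis}}(\mathscr Y_P)$ and $\mathcal B^{\mathrm{vis}}_p(\mathscr Y_P)$ denote the sets of globally visible and of $p$-adically visible points. *)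

theory Defs
  imports Complex_Main "HOL-Computational_Algebra.Computational_Algebra" "HOL-Library.Extended_Nat"
begin

definition lattice_point :: "int \<times> int \<Rightarrow> real \<times> real" where
  "lattice_point = map_prod real_of_int real_of_int"

definition branch :: "int poly \<Rightarrow> rat \<Rightarrow> real \<Rightarrow> real \<times> real" where
  "branch P q t = (t, of_rat q * poly (map_poly of_int P) t)"

definition branch_locus :: "int poly \<Rightarrow> (int \<times> int) set" where
  "branch_locus P = {Q. \<exists>q t. q > 0 \<and> t > 0 \<and> branch P q t = lattice_point Q}"

(* The library's multiplicity of p in 0 is 0, whereas the valuation of 0 is infinite. *)
definition val :: "nat \<Rightarrow> int \<Rightarrow> enat" where
  "val p x = (if x = 0 then \<infinity> else enat (multiplicity (int p) x))"

definition point_val :: "nat \<Rightarrow> int \<times> int \<Rightarrow> enat" where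
  "point_val p Q = min (val p (fst Q)) (val p (snd Q))"

(* When P is positive on the positive reals, a point of the branch locus determines
   its pair (q, t), so the quantification over all such pairs in the next two
   definitions ranges over that single pair. *)

definition visible_locus :: "int poly \<Rightarrow> (int \<times> int) set" where
  "visible_locus P = {Q \<in> branch_locus P.
     \<forall>q t. q > 0 \<longrightarrow> t > 0 \<longrightarrow> branch P q t = lattice_point Q \<longrightarrow>
       \<not> (\<exists>s. 0 < s \<and> s < t \<and> branch P q s \<in> range lattice_point)}"

definition padic_visible_locus :: "nat \<Rightarrow> int poly \<Rightarrow> (int \<times> int) set" where
  "padic_visible_locus p P = {Q \<in> branch_locus P.
     \<forall>q t. q > 0 \<longrightarrow> t > 0 \<longrightarrow> branch P q t = lattice_point Q \<longrightarrow>
       (\<forall>s R. 0 < s \<longrightarrow> s < t \<longrightarrow> branch P q s = lattice_point R \<longrightarrow>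
          point_val p Q \<le> point_val p R)}"

definition visibility_locally_detectable :: "int poly \<Rightarrow> bool" where
  "visibility_locally_detectable P \<longleftrightarrow>
     visible_locus P = (\<Inter>p\<in>{p. prime p}. padic_visible_locus p P)"

end

theory Submission
  imports Defs "HOL-Number_Theory.Cong"
begin

text \<open>
  The points of the branch \<open>\<phi>\<^sub>q\<close> through \<open>(m, n)\<close> that lie before \<open>(m, n)\<close> are the pairs
  \<open>(k, l)\<close> with \<open>0 < k < m\<close> and \<open>n * P k = l * P m\<close>. A globally visible point is \<open>p\<close>-adically
  visible for every \<open>p\<close>, vacuously, so only the converse inclusion matters.

  For \<open>P = T ^ d\<close>, write \<open>m = g * m'\<close> and \<open>k = g * k'\<close> with \<open>m', k'\<close> coprime. Then
  \<open>n * k' ^ d = l * m' ^ d\<close>, and a prime divisor of \<open>m' > 1\<close> divides \<open>m\<close> to a higher power than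
  \<open>k\<close> and \<open>n\<close> to a higher power than \<open>l\<close>. It witnesses that \<open>(m, n)\<close> is not \<open>p\<close>-adically visible
  (\<open>pure_power_hidden_prime\<close>).

  If \<open>P\<close> is not a power of \<open>T\<close>, it suffices to find a hidden point \<open>(m, n)\<close> with \<open>m, n\<close> coprime,
  because all its valuations vanish. Write \<open>P = T ^ r * R\<close> with \<open>R\<close> nonconstant and
  \<open>e = R 0 \<noteq> 0\<close>. The polynomial \<open>F y = R (e\<^sup>2 * y) / e\<close> has integer coefficients and
  \<open>F y \<equiv> 1\<close> modulo \<open>e * y\<close>. Given \<open>c \<ge> 2\<close> and \<open>y > 0\<close> with \<open>c ^ r\<close> dividing \<open>F y\<close>, put
  \<open>k = e\<^sup>2 * y\<close>, \<open>m = c * k\<close> and \<open>n = F (c * y)\<close>. Then \<open>n\<close> is coprime to \<open>m\<close> and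
  \<open>n * P k / P m = F y / c ^ r\<close> is an integer. Nonnegativity of the coefficients keeps
  \<open>n\<close> and \<open>P m\<close> positive, so that \<open>(m, n)\<close> lies on a branch with \<open>q > 0\<close>
  (\<open>hidden_coprime_point\<close>).

  What remains is that a nonconstant \<open>F\<close> with \<open>F 0 = 1\<close> takes, for every \<open>r\<close>, a value divisible
  by \<open>c ^ r\<close> for some \<open>c \<ge> 2\<close> (\<open>perfect_power_divides_value\<close>). A divisor \<open>G\<close> of \<open>F\<close> of minimal positive
  degree has only constants in common with its derivative, so \<open>u * G + v * G' = D\<close> for a nonzero
  integer \<open>D\<close> (\<open>bezout_constant\<close>). At a suitable multiple \<open>z\<close> of \<open>D\<close>, the number
  \<open>c = \<bar>G z\<bar>\<close> is at least \<open>2\<close>, and it is coprime to \<open>D\<close> because \<open>G 0\<close> is a unit; hence \<open>c\<close> is coprime to \<open>G' z\<close>, and Newton's iteration lifts the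
  root \<open>z\<close> of \<open>G\<close> modulo \<open>c\<close> to a root modulo \<open>c ^ r\<close> (\<open>hensel_lift_coprime\<close>).
\<close>

section \<open>Integer polynomials with values divisible by high powers\<close>

lemma poly_dvd_poly: "f dvd g \<Longrightarrow> poly f x dvd poly g x"
  by (auto elim!: dvdE)

lemma poly_taylor_second_order:
  fixes f :: "'a::{comm_ring_1,semiring_no_zero_divisors} poly"
  shows "\<exists>e. poly f (x + h) = poly f x + h * poly (pderiv f) x + h\<^sup>2 * e"
proof (induction f)
  case 0
  show ?case by (rule exI[of _ 0]) simp
next
  case (pCons a f)
  then obtain e where e: "poly f (x + h) = poly f x + h * poly (pderiv f) x + h\<^sup>2 * e"
    by blast
  show ?case
    by (rule exI[of _ "poly (pderiv f) x + (x + h) * e"])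
       (simp only: poly_pCons pderiv_pCons poly_add e, simp add: algebra_simps power2_eq_square)
qed

lemma diff_dvd_poly_diff:
  fixes f :: "'a::{comm_ring_1,semiring_no_zero_divisors} poly"
  shows "x - y dvd poly f x - poly f y"
proof -
  obtain e where "poly f (y + (x - y)) =
      poly f y + (x - y) * poly (pderiv f) y + (x - y)\<^sup>2 * e"
    using poly_taylor_second_order by blast
  then have "poly f x - poly f y = (x - y) * (poly (pderiv f) y + (x - y) * e)"
    by (simp add: algebra_simps power2_eq_square)
  then show ?thesis by (rule dvdI)
qed

text \<open>Newton's step only has to invert the derivative modulo \<open>c\<close>, so coprimality to \<open>c\<close> is enough
  and \<open>c\<close> may be composite.\<close>

lemma hensel_lift_coprime:
  fixes G :: "int poly"
  assumes root: "c dvd poly G z" and unit: "coprime (poly (pderiv G) z) c"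
  shows "\<exists>x. c dvd x - z \<and> c ^ r dvd poly G x"
proof (induction r)
  case 0
  show ?case by (rule exI[of _ z]) simp
next
  case (Suc r)
  \<comment> \<open>Newton's quadratic error is divisible by \<open>c ^ (2 * r)\<close>, hence by \<open>c ^ Suc r\<close> once \<open>r \<ge> 1\<close>.\<close>
  show ?case
  proof (cases "r = 0")
    case True
    then show ?thesis using root by (intro exI[of _ z]) simp
  next
    case False
    from Suc obtain x b where x: "c dvd x - z" and b: "poly G x = c ^ r * b"
      by (meson dvdE)
    have "c dvd poly (pderiv G) x - poly (pderiv G) z"
      using x diff_dvd_poly_diff dvd_trans by blast
    then have "[poly (pderiv G) x = poly (pderiv G) z] (mod c)"
      by (simp add: cong_iff_dvd_diff)
    then have "coprime (poly (pderiv G) x) c"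
      using unit cong_imp_coprime cong_sym by blast
    then obtain i where "[poly (pderiv G) x * i = 1] (mod c)"
      using cong_solve_coprime_int by blast
    then obtain j where j: "poly (pderiv G) x * i = 1 + c * j"
      by (metis cong_iff_lin cong_sym)
    define h where "h = - (c ^ r * b * i)"
    obtain e where e: "poly G (x + h) = poly G x + h * poly (pderiv G) x + h\<^sup>2 * e"
      using poly_taylor_second_order by blast
    have "poly G x + h * poly (pderiv G) x = c ^ r * b * (1 - poly (pderiv G) x * i)"
      by (simp add: b h_def algebra_simps)
    then have "c ^ Suc r dvd poly G x + h * poly (pderiv G) x"
      by (simp add: j)
    moreover have "c ^ Suc r dvd h\<^sup>2"
    proof -
      have "c ^ Suc r dvd c ^ (2 * r)"
        using False by (intro le_imp_power_dvd) simp
      moreover have "h\<^sup>2 = c ^ (2 * r) * (b * i)\<^sup>2"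
        by (simp add: h_def power_mult_distrib power_even_eq mult.assoc)
      ultimately show ?thesis by simp
    qed
    ultimately have "c ^ Suc r dvd poly G (x + h)"
      unfolding e by (simp add: dvd_add)
    moreover have "c dvd x + h - z"
    proof -
      have "c dvd h" using False by (simp add: h_def)
      then show ?thesis using x by (metis add_diff_eq add.commute dvd_add)
    qed
    ultimately show ?thesis by blast
  qed
qed

text \<open>Gauss's lemma: denominators introduced by division over the fraction field can be dropped.\<close>

lemma primitive_part_dvd_of_dvd_smult:
  fixes f g :: "int poly"
  assumes "g dvd smult a f" and "a \<noteq> 0"
  shows "primitive_part g dvd f"
proof -
  have "primitive_part g dvd primitive_part (smult a f)"
    using assms(1) by (rule primitive_part_dvd_primitive_partI)
  also have "\<dots> dvd primitive_part f"
    using assms(2) by (simp add: primitive_part_smult sgn_if)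
  also have "\<dots> dvd f"
    by (metis content_times_primitive_part dvd_smult dvd_refl)
  finally show ?thesis .
qed

text \<open>A combination of minimal degree divides both polynomials up to integer factors, by
  pseudo-division; its primitive part is therefore a common divisor.\<close>

lemma bezout_constant:
  fixes f g :: "int poly"
  assumes "f \<noteq> 0" and common: "\<And>h. h dvd f \<Longrightarrow> h dvd g \<Longrightarrow> degree h = 0"
  shows "\<exists>u v D. D \<noteq> 0 \<and> u * f + v * g = [:D:]"
proof -
  define comb where "comb w \<longleftrightarrow> (\<exists>u v. w = u * f + v * g)" for w
  have comb_f: "comb f" unfolding comb_def by (rule exI[of _ 1], rule exI[of _ 0]) simp
  have comb_g: "comb g" unfolding comb_def by (rule exI[of _ 0], rule exI[of _ 1]) simp
  obtain w where w: "w \<noteq> 0" "comb w"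
    and least: "\<And>x. x \<noteq> 0 \<Longrightarrow> comb x \<Longrightarrow> degree w \<le> degree x"
    using assms(1) comb_f
      ex_has_least_nat[of "\<lambda>x. x \<noteq> 0 \<and> comb x" f degree] by blast
  have dvd: "primitive_part w dvd x" if "comb x" for x
  proof -
    define rem where "rem = pseudo_mod x w"
    obtain a q where a: "a \<noteq> 0" and eq: "smult a x = w * q + rem"
      using pseudo_mod(1)[OF w(1)] unfolding rem_def by blast
    have "comb rem"
    proof -
      obtain u v u' v' where "x = u * f + v * g" "w = u' * f + v' * g"
        using \<open>comb x\<close> w(2) unfolding comb_def by blast
      then have "rem = ([:a:] * u - q * u') * f + ([:a:] * v - q * v') * g"
        using eq by (simp add: algebra_simps smult_add_right)
      then show ?thesis unfolding comb_def by blast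
    qed
    moreover have "rem = 0 \<or> degree rem < degree w"
      using pseudo_mod(2)[OF w(1)] unfolding rem_def .
    ultimately have "rem = 0" using least by force
    then have "w dvd smult a x" using eq by simp
    then show ?thesis using a by (rule primitive_part_dvd_of_dvd_smult)
  qed
  have "degree w = 0"
    using common[OF dvd[OF comb_f] dvd[OF comb_g]] by simp
  then obtain D where "w = [:D:]" using degree_eq_zeroE by blast
  then show ?thesis using w unfolding comb_def by (metis pCons_0_0)
qed

text \<open>The unit constant term makes \<open>G z\<close> coprime to \<open>D\<close> for every multiple \<open>z\<close> of \<open>D\<close>, where
  \<open>G\<close> is the chosen divisor of \<open>F\<close> and \<open>D\<close> its Bezout constant; the Bezout
  identity then turns this into coprimality to the derivative.\<close>

lemma perfect_power_divides_value:
  fixes F :: "int poly"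
  assumes "degree F > 0" and unit: "poly F 0 dvd 1"
  shows "\<exists>c y. c \<ge> 2 \<and> y > 0 \<and> c ^ r dvd poly F y"
proof -
  obtain G where G: "G dvd F" "degree G > 0"
    and least: "\<And>H. H dvd F \<Longrightarrow> degree H > 0 \<Longrightarrow> degree G \<le> degree H"
    using assms(1) ex_has_least_nat[of "\<lambda>H. H dvd F \<and> degree H > 0" F degree]
    by (metis dvd_refl)
  have G0: "poly G 0 dvd 1"
    using poly_dvd_poly[OF G(1)] unit dvd_trans by blast
  have common: "degree h = 0" if "h dvd G" "h dvd pderiv G" for h
  proof -
    have "degree h \<le> degree (pderiv G)"
      using that(2) G(2) by (intro dvd_imp_degree_le) (auto simp: pderiv_eq_0_iff)
    also have "\<dots> < degree G" using G(2) by (simp add: degree_pderiv)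
    finally show ?thesis using least[of h] that(1) G(1) dvd_trans by fastforce
  qed
  obtain u v D where D: "D \<noteq> 0" and bezout: "u * G + v * pderiv G = [:D:]"
    using bezout_constant[of G "pderiv G"] common G(2) by fastforce

  \<comment> \<open>A multiple of \<open>D\<close> where \<open>G\<close> takes none of the values \<open>0, 1, -1\<close>.\<close>
  obtain z where z: "D dvd z" "\<bar>poly G z\<bar> \<ge> 2"
  proof -
    have "finite {x. poly (G - [:a:]) x = 0}" for a
    proof (rule poly_roots_finite)
      show "G - [:a:] \<noteq> 0" using G(2) by auto
    qed
    then have fin: "finite (\<Union>a\<in>{-1,0,1}. {x. poly (G - [:a:]) x = 0})" by blast
    have "inj (\<lambda>j. D * j)" using D by (simp add: inj_on_def)
    then have "infinite (range (\<lambda>j. D * j))"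
      using finite_imageD infinite_UNIV_int by blast
    then obtain j where "D * j \<notin> (\<Union>a\<in>{-1,0,1}. {x. poly (G - [:a:]) x = 0})"
      using fin by (meson finite_subset image_subsetI)
    then show ?thesis by (intro that[of "D * j"]) auto
  qed
  define c where "c = \<bar>poly G z\<bar>"
  have "coprime (poly G z) D"
  proof (rule coprimeI)
    fix e assume e: "e dvd poly G z" "e dvd D"
    then have "e dvd poly G z - poly G 0"
      using z(1) diff_dvd_poly_diff[of z 0 G] by (metis diff_zero dvd_trans)
    then have "e dvd poly G 0" using dvd_diff[OF e(1)] by fastforce
    then show "is_unit e" using G0 dvd_trans by blast
  qed
  then have "coprime (poly (pderiv G) z) (poly G z)"
  proof (elim coprime_imp_coprime)
    fix e assume e: "e dvd poly (pderiv G) z" "e dvd poly G z"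
    have "poly u z * poly G z + poly v z * poly (pderiv G) z = D"
      using arg_cong[OF bezout, of "\<lambda>f. poly f z"] by simp
    then show "e dvd D" using e by (metis dvd_add dvd_mult)
  qed
  then obtain x where x: "c ^ r dvd poly G x"
    using hensel_lift_coprime[of c G z r] unfolding c_def by auto
  have c: "c \<ge> 2" using z(2) by (simp add: c_def)
  \<comment> \<open>Translating by a multiple of \<open>c ^ r\<close> makes the argument positive.\<close>
  define y where "y = x + c ^ r * (\<bar>x\<bar> + 1)"
  have "y > 0"
  proof -
    have "1 * (\<bar>x\<bar> + 1) \<le> c ^ r * (\<bar>x\<bar> + 1)"
      using c by (intro mult_right_mono) (auto intro: one_le_power)
    moreover have "0 < x + 1 * (\<bar>x\<bar> + 1)" by (simp add: abs_if)
    ultimately show ?thesis unfolding y_def by (meson add_left_mono less_le_trans)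
  qed
  moreover have "c ^ r dvd poly F y"
  proof -
    have "c ^ r dvd y - x" by (simp add: y_def)
    then have "c ^ r dvd poly G y - poly G x" using diff_dvd_poly_diff dvd_trans by blast
    then have "c ^ r dvd poly G y" using dvd_add[OF _ x] by fastforce
    then show ?thesis using poly_dvd_poly[OF G(1)] dvd_trans by blast
  qed
  ultimately show ?thesis using c by blast
qed

section \<open>Lattice points on the branches\<close>

lemma poly_map_poly_real_of_int:
  "poly (map_poly real_of_int P) (real_of_int x) = real_of_int (poly P x)"
  by (induction P) (simp_all add: map_poly_pCons)

lemma branch_eq_lattice_pointI:
  assumes "poly P m \<noteq> 0" and "n * poly P x = w * poly P m"
  shows "branch P (of_int n / of_int (poly P m)) (real_of_int x) = lattice_point (x, w)"
proof -
  have "real_of_int n * real_of_int (poly P x) = real_of_int w * real_of_int (poly P m)"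
    using assms(2) by (metis of_int_mult)
  then show ?thesis
    using assms(1)
    by (simp add: branch_def lattice_point_def poly_map_poly_real_of_int of_rat_divide field_simps)
qed

lemma visible_subset_padic_visible:
  "visible_locus P \<subseteq> padic_visible_locus p P"
  unfolding visible_locus_def padic_visible_locus_def by fastforce

section \<open>Pure powers\<close>

text \<open>The proof works for every prime divisor of \<open>m / gcd m k\<close>; one exists because \<open>k < m\<close>.\<close>

lemma pure_power_hidden_prime:
  fixes m n k l :: int
  assumes "d \<ge> 1" "0 < k" "k < m" "n > 0" "l > 0" and eq: "n * k ^ d = l * m ^ d"
  shows "\<exists>p. prime p \<and> point_val p (k, l) < point_val p (m, n)"
proof -
  define g where "g = gcd m k"
  have "g > 0" using assms by (simp add: g_def)
  obtain m' k' where m: "m = m' * g" and k: "k = k' * g" and cop: "coprime m' k'"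
    using gcd_coprime_exists[of m k] \<open>g > 0\<close> unfolding g_def by auto
  have pos: "m' > 0" "k' > 0" using m k assms \<open>g > 0\<close> by (metis less_trans zero_less_mult_pos2)+
  have "m' \<noteq> 1" using m k assms \<open>g > 0\<close> pos
    by (metis less_le_not_le mult_right_mono int_one_le_iff_zero_less less_imp_le)
  then obtain p' where p': "prime p'" "p' dvd m'"
    using pos prime_divisor_exists[of m'] by auto
  define p where "p = nat p'"
  have p: "prime (int p)" "int p dvd m'" using p' prime_ge_0_int unfolding p_def by auto
  have "n * k' ^ d = l * m' ^ d"
    using eq \<open>g > 0\<close> by (simp add: m k power_mult_distrib)
  then have "multiplicity (int p) (n * k' ^ d) = multiplicity (int p) (l * m' ^ d)" by simp
  moreover have k0: "multiplicity (int p) k' = 0"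
    using p cop by (metis coprime_common_divisor not_dvd_imp_multiplicity_0 not_prime_unit)
  moreover have m1: "multiplicity (int p) m' > 0"
    using p pos by (simp add: prime_multiplicity_gt_zero_iff)
  ultimately have "multiplicity (int p) l < multiplicity (int p) n"
    using p(1) pos assms
    by (simp add: prime_elem_multiplicity_mult_distrib prime_elem_multiplicity_power_distrib)
  moreover have "multiplicity (int p) k < multiplicity (int p) m"
    using p(1) pos \<open>g > 0\<close> k0 m1 by (simp add: m k prime_elem_multiplicity_mult_distrib)
  ultimately have "point_val p (k, l) < point_val p (m, n)"
    using assms by (simp add: point_val_def val_def min_def)
  then show ?thesis using p(1) by auto
qed

lemma pure_power_locally_detectable:
  assumes "d \<ge> 1"
  shows "visibility_locally_detectable (monom 1 d)"
proof -
  let ?P = "monom 1 d :: int poly"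
  have "Q \<in> visible_locus ?P" if Q: "\<And>p. prime p \<Longrightarrow> Q \<in> padic_visible_locus p ?P" for Q
  proof -
    have False
      if qt: "q > 0" "t > 0" "branch ?P q t = lattice_point Q"
        and s: "0 < s" "s < t" "branch ?P q s = lattice_point R" for q t s R
    proof -
      obtain m n k l where QR: "Q = (m, n)" "R = (k, l)" by fastforce
      have poly: "poly (map_poly real_of_int ?P) x = x ^ d" for x
        by (simp add: map_poly_monom poly_monom)
      have tm: "t = real_of_int m" and n: "real_of_rat q * t ^ d = real_of_int n"
        and sk: "s = real_of_int k" and l: "real_of_rat q * s ^ d = real_of_int l"
        using qt(3) s(3) unfolding QR branch_def lattice_point_def poly by auto
      have "real_of_int (n * k ^ d) = real_of_int (l * m ^ d)"
        by (simp add: tm sk flip: n l)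
      then have "n * k ^ d = l * m ^ d" by linarith
      moreover have "real_of_int n > 0" "real_of_int l > 0"
        using qt s by (simp_all flip: n l)
      ultimately obtain p where "prime p" "point_val p (k, l) < point_val p (m, n)"
        using pure_power_hidden_prime[of d k m n l] assms s tm sk by auto
      moreover have "point_val p Q \<le> point_val p R"
        using Q[OF \<open>prime p\<close>] qt s unfolding padic_visible_locus_def by blast
      ultimately show False by (simp add: QR)
    qed
    moreover have "Q \<in> branch_locus ?P"
      using Q[OF two_is_prime_nat] by (simp add: padic_visible_locus_def)
    ultimately show ?thesis unfolding visible_locus_def by fastforce
  qed
  then have "(\<Inter>p\<in>{p. prime p}. padic_visible_locus p ?P) \<subseteq> visible_locus ?P"
    by (intro subsetI) simp
  moreover have "visible_locus ?P \<subseteq> (\<Inter>p\<in>{p. prime p}. padic_visible_locus p ?P)"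
    by (intro INT_greatest visible_subset_padic_visible)
  ultimately show ?thesis
    unfolding visibility_locally_detectable_def by (intro equalityI)
qed

section \<open>Other polynomials\<close>

lemma poly_nonneg_of_coeff_nonneg:
  fixes f :: "'a::linordered_idom poly"
  assumes "\<And>i. coeff f i \<ge> 0" and "x \<ge> 0"
  shows "poly f x \<ge> 0"
  using assms by (simp add: poly_altdef sum_nonneg)

text \<open>The substitution \<open>y \<mapsto> (R 0)\<^sup>2 * y\<close> makes the constant term \<open>R 0\<close> a common factor of
  the coefficients, and what remains is \<open>1\<close> modulo \<open>R 0\<close>: this removes the primes dividing \<open>R 0\<close>,
  the only obstruction to the coprimality of \<open>R m\<close> and \<open>m\<close>.\<close>

lemma hidden_coprime_point:
  fixes R :: "int poly" and r :: nat
  assumes nonneg: "\<And>i. coeff R i \<ge> 0" and const: "coeff R 0 \<noteq> 0" and deg: "degree R > 0"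
    and P_def: "P = monom 1 r * R"
  shows "\<exists>m n k l. 0 < k \<and> k < m \<and> n > 0 \<and> poly P m > 0 \<and> coprime m n \<and>
    n * poly P k = l * poly P m"
proof -
  obtain e S where R: "R = pCons e S" by (cases R)
  have e: "e > 0" using nonneg[of 0] const by (simp add: R)
  have S: "S \<noteq> 0" "\<And>i. coeff S i \<ge> 0"
    using deg nonneg[of "Suc _"] by (auto simp: R)
  define F where "F = pCons 1 (smult e (S \<circ>\<^sub>p [:0, e\<^sup>2:]))"
  have F: "poly F y = 1 + e * y * poly S (e\<^sup>2 * y)" for y
    by (simp add: F_def poly_pcompose algebra_simps)
  have RF: "poly R (e\<^sup>2 * y) = e * poly F y" for y
    by (simp add: R F algebra_simps power2_eq_square)
  have Fpos: "poly F y > 0" if "y \<ge> 0" for y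
    using poly_nonneg_of_coeff_nonneg[of S "e\<^sup>2 * y"] that e S(2)
    by (simp add: F add_pos_nonneg)
  have "S \<circ>\<^sub>p [:0, e\<^sup>2:] \<noteq> 0"
    using S(1) e by (simp add: pcompose_eq_0_iff)
  then have "degree F > 0" using e by (simp add: F_def)
  moreover have "poly F 0 dvd 1" by (simp add: F)
  ultimately obtain c y w where c: "c \<ge> 2" and y: "y > 0" and w: "poly F y = c ^ r * w"
    using perfect_power_divides_value[of F r] by (metis dvd_def)
  define k where "k = e\<^sup>2 * y"
  have m: "c * k = e\<^sup>2 * (c * y)" by (simp add: k_def)
  have k: "0 < k" using e y by (simp add: k_def)
  have "poly P (c * k) = c ^ r * k ^ r * (e * poly F (c * y))"
    unfolding P_def by (simp add: m RF poly_monom) (simp add: k_def power_mult_distrib)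
  moreover have "poly P k = k ^ r * (e * (c ^ r * w))"
    unfolding P_def by (simp add: poly_monom k_def RF w)
  ultimately have "poly F (c * y) * poly P k = w * poly P (c * k)"
    and "poly P (c * k) > 0"
    using k c e y Fpos[of "c * y"] by simp_all
  moreover have "k < c * k" using k c by simp
  moreover have "coprime (c * k) (poly F (c * y))"
  proof -
    have "coprime (e * (c * y)) (poly F (c * y))"
      unfolding F by (rule coprimeI) (metis dvd_add_left_iff dvd_mult2)
    then show ?thesis by (simp add: k_def power2_eq_square)
  qed
  moreover have "poly F (c * y) > 0" using Fpos c y by simp
  ultimately show ?thesis using k by blast
qed

text \<open>Coprime coordinates have minimum valuation \<open>0\<close> at every prime, so no lattice point before
  \<open>(m, n)\<close> can hide it \<open>p\<close>-adically.\<close>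

lemma hidden_coprime_point_not_locally_detectable:
  assumes "0 < k" "k < m" "n > 0" "poly P m > 0" "coprime m n"
    and eq: "n * poly P k = l * poly P m"
  shows "\<not> visibility_locally_detectable P"
proof -
  define q :: rat where "q = of_int n / of_int (poly P m)"
  have q: "q > 0" using assms by (simp add: q_def)
  have m: "branch P q (real_of_int m) = lattice_point (m, n)"
    and k: "branch P q (real_of_int k) = lattice_point (k, l)"
    using assms branch_eq_lattice_pointI[of P m] unfolding q_def by auto
  have locus: "(m, n) \<in> branch_locus P"
    unfolding branch_locus_def using q m assms(1,2)
    by (intro CollectI exI[of _ q] exI[of _ "real_of_int m"]) simp
  have "point_val p (m, n) = 0" if "prime p" for p
  proof -
    have "\<not> (int p dvd m \<and> int p dvd n)"
      using assms(5) that by (metis coprime_common_divisor not_prime_unit prime_nat_int_transfer)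
    then show ?thesis
      using assms by (auto simp: point_val_def val_def not_dvd_imp_multiplicity_0 zero_enat_def)
  qed
  then have "(m, n) \<in> (\<Inter>p\<in>{p. prime p}. padic_visible_locus p P)"
    using locus unfolding padic_visible_locus_def by fastforce
  moreover have "(m, n) \<notin> visible_locus P"
  proof
    assume "(m, n) \<in> visible_locus P"
    then have "\<forall>q t. q > 0 \<longrightarrow> t > 0 \<longrightarrow> branch P q t = lattice_point (m, n) \<longrightarrow>
        \<not> (\<exists>s. 0 < s \<and> s < t \<and> branch P q s \<in> range lattice_point)"
      unfolding visible_locus_def by blast
    then have "\<not> (\<exists>s. 0 < s \<and> s < real_of_int m \<and> branch P q s \<in> range lattice_point)"
      using q m assms(1,2) by (metis less_trans of_int_0_less_iff)
    moreover have "0 < real_of_int k" "real_of_int k < real_of_int m" using assms by simp_all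
    ultimately show False using k by (metis rangeI)
  qed
  ultimately show ?thesis unfolding visibility_locally_detectable_def by blast
qed

theorem theorem1p5:
  fixes d :: nat and a :: "nat \<Rightarrow> int" and P :: "int poly"
  assumes "d \<ge> 1"
    and "\<And>i. i \<in> {1..<d} \<Longrightarrow> a i \<ge> 0"
    and "P = monom 1 d + (\<Sum>i\<in>{1..<d}. monom (a i) i)"
  shows "visibility_locally_detectable P \<longleftrightarrow> P = monom 1 d"
proof
  assume "P = monom 1 d"
  then show "visibility_locally_detectable P"
    using pure_power_locally_detectable assms(1) by simp
next
  assume detectable: "visibility_locally_detectable P"
  have lead: "coeff P d = 1"
    unfolding assms(3) by (simp add: coeff_sum)
  have nonneg: "coeff P i \<ge> 0" for i
    unfolding assms(3) using assms(2) by (auto simp: coeff_sum intro!: sum_nonneg add_nonneg_nonneg)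
  have "P \<noteq> 0" using lead by auto
  define r where "r = order 0 P"
  obtain R where P: "P = monom 1 r * R" and "\<not> [:- 0, 1:] dvd R"
    using order_decomp[OF \<open>P \<noteq> 0\<close>, of 0] by (auto simp: r_def monom_altdef)
  then have R0: "coeff R 0 \<noteq> 0"
    using poly_eq_0_iff_dvd[of R 0] by (simp add: poly_0_coeff_0)
  have "coeff R i \<ge> 0" for i
    using nonneg[of "r + i"] by (simp add: P coeff_monom_mult)
  then have "degree R = 0"
    using hidden_coprime_point[OF _ R0 _ P] detectable
      hidden_coprime_point_not_locally_detectable by blast
  then obtain b where "R = [:b:]" using degree_eq_zeroE by blast
  then have "P = monom b r" by (simp add: P smult_monom)
  then show "P = monom 1 d" using lead by (auto split: if_splits)
qed

end
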